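(* Let $(X,\|\cdot\|)$ be a real normed space equipped with a compatible regular pairing $\llbracket\cdot,\cdot\rrbracket$, and let $T$ be an operator on $X$. Then: (a) $T$ is $\ell$-Lipschitz if and only if $\mathrm{SRG}_L(T)\subseteq\{z\in\bar{\mathbb{C}} : |z|\le \ell\}$; (b) $T$ is one-sided $c$-Lipschitz if and only if $\mathrm{SRG}_L(T)\subseteq\{z\in\bar{\mathbb{C}} : \operatorname{Re} z\le c\}$; (c) $T$ is $\mu$-strongly monotone if and only if $\mathrm{SRG}_L(T)\subseteq\{z\in\bar{\mathbb{C}} : \operatorname{Re} z\ge \mu\}$; (d) $T$ is $\gamma$-cocoercive if and only if $\mathrm{SRG}_L(T)\subseteq\left\{z\in\bar{\mathbb{C}} : \left|z-\tfrac{1}{2\gamma}\right|\le\tfrac{1}{2\gamma}\right\}$.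
   Context: Weak and regular pairings. A weak pairing on a real normed space $(X,\|\cdot\|)$ is a map $\llbracket\cdot,\cdot\rrbracket:X\times X\to\mathbb{R}$ that satisfies: subadditivity in the first argument, $\llbracket x_1+x_2,y\rrbracket\le\llbracket x_1,y\rrbracket+\llbracket x_2,y\rrbracket$; weak homogeneity, $\llbracket \alpha x,y\rrbracket=\llbracket x,\alpha y\rrbracket=\alpha\llbracket x,y\rrbracket$ for $\alpha\ge 0$ and $\llbracket -x,-y\rrbracket=\llbracket x,y\rrbracket$; positive definiteness, $\llbracket x,x\rrbracket>0$ for $x\ne 0$; and the Cauchy–Schwarz inequality, $|\llbracket x,y\rrbracket|\le\llbracket x,x\rrbracket^{1/2}\llbracket y,y\rrbracket^{1/2}$. It is compatible with the norm if $\llbracket x,x\rrbracket=\|x\|^2$ for all $x\in X$. A compatible weak pairing is regular if it satisfies the straight angle property $\llbracket -x,x\rrbracket=-\|x\|^2$ for all $x\in X$; equivalently, partial linearity $\llbracket x+ay,y\rrbracket=\llbracket x,y\rrbracket+a\|y\|^2$ for all $x,y\in X$, $a\in\mathbb{R}$. Left angle. For nonzero $x,y\in X$, $\cos_L(x,y)=\dfrac{\llbracket y,x\rrbracket}{\|x\|\|y\|}\in[-1,1]$ and $\angle_L(x,y)=\arccos(\cos_L(x,y))$. Operators. An operator $T$ on $X$ is a possibly set-valued map, identified with its graph $\operatorname{gra}(T)=\{(x,y): y\in T(x)\}\subseteq X\times X$. The incremental graph is $\mathrm{i}\!\operatorname{gra}(T)=\operatorname{gra}(T)-\operatorname{gra}(T)=\{(x_1-x_2,y_1-y_2):(x_1,y_1),(x_2,y_2)\in\operatorname{gra}(T)\}$.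 Left SRG. With $\bar{\mathbb{C}}=\mathbb{C}\cup\{\infty\}$ the extended complex plane, the left Scaled Relative Graph of $T$ is $$\mathrm{SRG}_L(T)=\left\{\tfrac{\|y\|}{\|x\|}e^{\pm i\angle_L(x,y)} : (x,y)\in\mathrm{i}\!\operatorname{gra}(T)\right\}\subseteq\bar{\mathbb{C}}.$$ By convention the pair $(0,0)$ contributes no point ($0/0$ is excluded); a pair $(x,0)$ with $x\ne0$ contributes the point $0$, and a pair $(0,y)$ with $y\neq 0$ contributes the point $\infty$. Operator properties. $T$ is: $\ell$-Lipschitz, with $\ell>0$, if $\|y\|\le\ell\|x\|$ for all $(x,y)\in\mathrm{i}\!\operatorname{gra}(T)$; one-sided $c$-Lipschitz, with $c\in\mathbb{R}$, if $\llbracket y,x\rrbracket\le c\|x\|^2$ for all $(x,y)\in\mathrm{i}\!\operatorname{gra}(T)$; $\mu$-strongly monotone, with $\mu\ge0$, if $\llbracket y,x\rrbracket\ge\mu\|x\|^2$ for all $(x,y)\in\mathrm{i}\!\operatorname{gra}(T)$; $\gamma$-cocoercive, with $\gamma>0$, if $\llbracket y,x\rrbracket\ge\gamma\|y\|^2$ for all $(x,y)\in\mathrm{i}\!\operatorname{gra}(T)$. *)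

theory Defs
  imports Complex_Main "HOL-Library.Extended_Real"
begin

locale weak_pairing =
  fixes P :: "'a::real_normed_vector \<Rightarrow> 'a \<Rightarrow> real"
  assumes subadd: "P (x1 + x2) y \<le> P x1 y + P x2 y"
    and homog_left: "\<alpha> \<ge> 0 \<Longrightarrow> P (\<alpha> *\<^sub>R x) y = \<alpha> * P x y"
    and homog_right: "\<alpha> \<ge> 0 \<Longrightarrow> P x (\<alpha> *\<^sub>R y) = \<alpha> * P x y"
    and minus_minus: "P (- x) (- y) = P x y"
    and pos_def: "x \<noteq> 0 \<Longrightarrow> P x x > 0"
    and Cauchy_Schwarz: "\<bar>P x y\<bar> \<le> sqrt (P x x) * sqrt (P y y)"

locale compatible_pairing = weak_pairing +
  assumes compatible: "P x x = (norm x)\<^sup>2"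

locale regular_pairing = compatible_pairing +
  assumes straight_angle: "P (- x) x = - (norm x)\<^sup>2"

text \<open>The pairing is read in swapped order. Both functions are only meaningful
  for nonzero arguments.\<close>

definition cos_L :: "('a::real_normed_vector \<Rightarrow> 'a \<Rightarrow> real) \<Rightarrow> 'a \<Rightarrow> 'a \<Rightarrow> real" where
  "cos_L P x y = P y x / (norm x * norm y)"

definition angle_L :: "('a::real_normed_vector \<Rightarrow> 'a \<Rightarrow> real) \<Rightarrow> 'a \<Rightarrow> 'a \<Rightarrow> real" where
  "angle_L P x y = arccos (cos_L P x y)"

definition gra :: "('a \<Rightarrow> 'a set) \<Rightarrow> ('a \<times> 'a) set" where
  "gra T = {(x, y). y \<in> T x}"

definition igra :: "('a::real_normed_vector \<Rightarrow> 'a set) \<Rightarrow> ('a \<times> 'a) set" where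
  "igra T = {(x1 - x2, y1 - y2) | x1 y1 x2 y2. (x1, y1) \<in> gra T \<and> (x2, y2) \<in> gra T}"

datatype ext_complex = Fin complex | Infinity

primrec ext_cmod :: "ext_complex \<Rightarrow> ereal" where
  "ext_cmod (Fin z) = ereal (cmod z)"
| "ext_cmod Infinity = \<infinity>"

primrec ext_diff :: "ext_complex \<Rightarrow> complex \<Rightarrow> ext_complex" where
  "ext_diff (Fin z) w = Fin (z - w)"
| "ext_diff Infinity w = Infinity"

text \<open>Half-planes of the extended plane are closed sets of the sphere, so they contain the
  point at infinity. This is needed for multi-valued operators: a pair \<open>(0, y)\<close> with
  \<open>y \<noteq> 0\<close> satisfies every one-sided Lipschitz and strong monotonicity inequality,
  while it contributes the point at infinity to the scaled relative graph.\<close>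

definition Re_le_halfplane :: "real \<Rightarrow> ext_complex set" where
  "Re_le_halfplane c = insert Infinity (Fin ` {z. Re z \<le> c})"

definition Re_ge_halfplane :: "real \<Rightarrow> ext_complex set" where
  "Re_ge_halfplane c = insert Infinity (Fin ` {z. Re z \<ge> c})"

definition SRG_points :: "('a::real_normed_vector \<Rightarrow> 'a \<Rightarrow> real) \<Rightarrow> 'a \<Rightarrow> 'a \<Rightarrow> ext_complex set" where
  "SRG_points P x y =
    (if x = 0 \<and> y = 0 then {}
     else if x = 0 then {Infinity}
     else if y = 0 then {Fin 0}
     else {Fin (of_real (norm y / norm x) * exp (\<i> * of_real (angle_L P x y))),
           Fin (of_real (norm y / norm x) * exp (- \<i> * of_real (angle_L P x y)))})"

definition SRG_L :: "('a::real_normed_vector \<Rightarrow> 'a \<Rightarrow> real) \<Rightarrow> ('a \<Rightarrow> 'a set) \<Rightarrow> ext_complex set" where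
  "SRG_L P T = (\<Union>(x, y)\<in>igra T. SRG_points P x y)"

definition lipschitz_op :: "real \<Rightarrow> ('a::real_normed_vector \<Rightarrow> 'a set) \<Rightarrow> bool" where
  "lipschitz_op l T \<longleftrightarrow> (\<forall>(x, y)\<in>igra T. norm y \<le> l * norm x)"

definition one_sided_lipschitz ::
    "('a::real_normed_vector \<Rightarrow> 'a \<Rightarrow> real) \<Rightarrow> real \<Rightarrow> ('a \<Rightarrow> 'a set) \<Rightarrow> bool" where
  "one_sided_lipschitz P c T \<longleftrightarrow> (\<forall>(x, y)\<in>igra T. P y x \<le> c * (norm x)\<^sup>2)"

definition strongly_monotone ::
    "('a::real_normed_vector \<Rightarrow> 'a \<Rightarrow> real) \<Rightarrow> real \<Rightarrow> ('a \<Rightarrow> 'a set) \<Rightarrow> bool" where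
  "strongly_monotone P \<mu> T \<longleftrightarrow> (\<forall>(x, y)\<in>igra T. P y x \<ge> \<mu> * (norm x)\<^sup>2)"

definition cocoercive ::
    "('a::real_normed_vector \<Rightarrow> 'a \<Rightarrow> real) \<Rightarrow> real \<Rightarrow> ('a \<Rightarrow> 'a set) \<Rightarrow> bool" where
  "cocoercive P \<gamma> T \<longleftrightarrow> (\<forall>(x, y)\<in>igra T. P y x \<ge> \<gamma> * (norm y)\<^sup>2)"

end

theory Submission imports Defs begin

text \<open>A pair \<open>(x, y)\<close> with \<open>x \<noteq> 0\<close> contributes a conjugate pair of points of modulus
  \<open>\<parallel>y\<parallel> / \<parallel>x\<parallel>\<close> and real part \<open>P y x / \<parallel>x\<parallel>\<^sup>2\<close>, so each operator property becomes, pair by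
  pair, a condition on modulus and real part; for cocoercivity, \<open>\<bar>z - 1/(2\<gamma>)\<bar> \<le> 1/(2\<gamma>)\<close>
  unfolds to \<open>\<gamma> \<bar>z\<bar>\<^sup>2 \<le> Re z\<close>.\<close>

lemma SRG_L_subset_iff: "SRG_L P T \<subseteq> S \<longleftrightarrow> (\<forall>(x, y)\<in>igra T. SRG_points P x y \<subseteq> S)"
  by (auto simp: SRG_L_def)

lemma Fin_mem_Re_le_halfplane: "Fin z \<in> Re_le_halfplane c \<longleftrightarrow> Re z \<le> c"
  by (auto simp: Re_le_halfplane_def)

lemma Fin_mem_Re_ge_halfplane: "Fin z \<in> Re_ge_halfplane c \<longleftrightarrow> Re z \<ge> c"
  by (auto simp: Re_ge_halfplane_def)

lemma (in weak_pairing) zero_left [simp]: "P 0 y = 0"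
  using homog_left[of 0 0 y] by simp

lemma (in weak_pairing) zero_right [simp]: "P x 0 = 0"
  using homog_right[of 0 x 0] by simp

text \<open>Cauchy-Schwarz and compatibility bound the numerator; a zero argument gives 0 by
  division by zero. The bound is what makes \<open>arccos\<close> invertible by \<open>cos\<close>
  at this value.\<close>

lemma (in compatible_pairing) abs_cos_L_le_one: "\<bar>cos_L P x y\<bar> \<le> 1"
proof -
  have "\<bar>P y x\<bar> \<le> norm x * norm y"
    using Cauchy_Schwarz[of y x] by (simp add: compatible mult.commute)
  then show ?thesis
    by (cases "norm x * norm y = 0") (auto simp: cos_L_def abs_mult divide_le_eq_1)
qed

lemma (in compatible_pairing) SRG_points_conjugate_pair:
  assumes "x \<noteq> 0"
  obtains z where "SRG_points P x y = {Fin z, Fin (cnj z)}"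
    and "cmod z = norm y / norm x" and "Re z = P y x / (norm x)\<^sup>2"
proof (cases "y = 0")
  case True
  with assms show ?thesis
    \<comment> \<open>The single point 0 is its own conjugate, so the angle plays no part
      here.\<close>
    by (intro that[of 0]) (auto simp: SRG_points_def)
next
  case False
  define \<theta> where "\<theta> = angle_L P x y"
  define z where "z = of_real (norm y / norm x) * exp (\<i> * of_real \<theta>)"
  have "cos \<theta> = cos_L P x y"
    using abs_cos_L_le_one[of x y] by (simp add: \<theta>_def angle_L_def cos_arccos_abs)
  then have "Re z = P y x / (norm x)\<^sup>2"
    using assms False by (simp add: z_def Re_exp cos_L_def field_simps power2_eq_square)
  moreover have "cmod z = norm y / norm x"
    by (simp add: z_def norm_mult norm_divide)
  moreover have "cnj z = of_real (norm y / norm x) * exp (- \<i> * of_real \<theta>)"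
    unfolding complex_eq_iff z_def by (simp add: Re_exp Im_exp)
  then have "SRG_points P x y = {Fin z, Fin (cnj z)}"
    unfolding SRG_points_def \<theta>_def[symmetric] z_def[symmetric] using assms False by simp
  ultimately show ?thesis
    using that by blast
qed

lemma (in compatible_pairing) SRG_points_subset_disc_iff:
  assumes "0 < l"
  shows "SRG_points P x y \<subseteq> {z. ext_cmod z \<le> ereal l} \<longleftrightarrow> norm y \<le> l * norm x"
proof (cases "x = 0")
  case True
  \<comment> \<open>If y is nonzero, the point at infinity lies outside the disc and
    \<open>norm y \<le> 0\<close> fails; if y = 0, both sides hold.\<close>
  then show ?thesis by (auto simp: SRG_points_def)
next
  case False
  then obtain z where "SRG_points P x y = {Fin z, Fin (cnj z)}" "cmod z = norm y / norm x"
    by (rule SRG_points_conjugate_pair)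
  with False show ?thesis by (simp add: pos_divide_le_eq)
qed

text \<open>For x = 0 the inequality reads 0 \<le> 0, which matches the half-plane containing
  \<open>Infinity\<close>; otherwise z and \<open>cnj z\<close> share their real part.\<close>

lemma (in compatible_pairing) SRG_points_subset_Re_le_iff:
  "SRG_points P x y \<subseteq> Re_le_halfplane c \<longleftrightarrow> P y x \<le> c * (norm x)\<^sup>2"
proof (cases "x = 0")
  case True
  then show ?thesis by (auto simp: SRG_points_def Re_le_halfplane_def)
next
  case False
  then obtain z where "SRG_points P x y = {Fin z, Fin (cnj z)}" "Re z = P y x / (norm x)\<^sup>2"
    by (rule SRG_points_conjugate_pair)
  with False show ?thesis by (simp add: Fin_mem_Re_le_halfplane pos_divide_le_eq)
qed

lemma (in compatible_pairing) SRG_points_subset_Re_ge_iff: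
  "SRG_points P x y \<subseteq> Re_ge_halfplane \<mu> \<longleftrightarrow> P y x \<ge> \<mu> * (norm x)\<^sup>2"
proof (cases "x = 0")
  case True
  then show ?thesis by (auto simp: SRG_points_def Re_ge_halfplane_def)
next
  case False
  then obtain z where "SRG_points P x y = {Fin z, Fin (cnj z)}" "Re z = P y x / (norm x)\<^sup>2"
    by (rule SRG_points_conjugate_pair)
  with False show ?thesis by (simp add: Fin_mem_Re_ge_halfplane pos_le_divide_eq)
qed

text \<open>With a = 1/(2\<gamma>), squaring and expanding the left side produces a square of a on
  both sides, which cancels; the cross term is 2a Re z = Re z / \<gamma>.\<close>

lemma cmod_diff_inverse_le_iff:
  assumes "0 < \<gamma>"
  shows "cmod (z - of_real (1 / (2 * \<gamma>))) \<le> 1 / (2 * \<gamma>) \<longleftrightarrow> \<gamma> * (cmod z)\<^sup>2 \<le> Re z"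
proof -
  have "cmod (z - of_real (1 / (2 * \<gamma>))) \<le> 1 / (2 * \<gamma>)
      \<longleftrightarrow> (cmod (z - of_real (1 / (2 * \<gamma>))))\<^sup>2 \<le> (1 / (2 * \<gamma>))\<^sup>2"
    using assms by (simp add: power2_le_iff_abs_le)
  also have "(cmod (z - of_real (1 / (2 * \<gamma>))))\<^sup>2 = (cmod z)\<^sup>2 - Re z / \<gamma> + (1 / (2 * \<gamma>))\<^sup>2"
    unfolding cmod_power2 using assms by (simp add: power2_diff)
  also have "\<dots> \<le> (1 / (2 * \<gamma>))\<^sup>2 \<longleftrightarrow> \<gamma> * (cmod z)\<^sup>2 \<le> Re z"
    using assms by (simp add: le_divide_eq mult.commute)
  finally show ?thesis .
qed

lemma (in compatible_pairing) SRG_points_subset_cocoercive_disc_iff: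
  assumes "0 < \<gamma>"
  shows "SRG_points P x y \<subseteq> {z. ext_cmod (ext_diff z (of_real (1 / (2 * \<gamma>)))) \<le> ereal (1 / (2 * \<gamma>))}
    \<longleftrightarrow> P y x \<ge> \<gamma> * (norm y)\<^sup>2"
proof (cases "x = 0")
  case True
  \<comment> \<open>Infinity is outside the disc, and \<open>P y 0 = 0\<close> with \<gamma> > 0
    forces y = 0.\<close>
  with assms show ?thesis by (auto simp: SRG_points_def mult_le_0_iff)
next
  case False
  then obtain z where z: "SRG_points P x y = {Fin z, Fin (cnj z)}"
      "cmod z = norm y / norm x" "Re z = P y x / (norm x)\<^sup>2"
    by (rule SRG_points_conjugate_pair)
  have "SRG_points P x y \<subseteq> {z. ext_cmod (ext_diff z (of_real (1 / (2 * \<gamma>)))) \<le> ereal (1 / (2 * \<gamma>))}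
      \<longleftrightarrow> \<gamma> * (cmod z)\<^sup>2 \<le> Re z"
    using cmod_diff_inverse_le_iff[OF assms, of z] cmod_diff_inverse_le_iff[OF assms, of "cnj z"]
    \<comment> \<open>The \<open>del\<close> keeps the centre in the form in which the two instances
      state it.\<close>
    by (simp add: z(1) del: of_real_divide of_real_mult)
  also have "\<dots> \<longleftrightarrow> P y x \<ge> \<gamma> * (norm y)\<^sup>2"
    using False by (simp add: z(2,3) power_divide divide_le_cancel)
  finally show ?thesis .
qed

theorem theorem1:
  fixes P :: "'a::real_normed_vector \<Rightarrow> 'a \<Rightarrow> real"
    and T :: "'a \<Rightarrow> 'a set"
  assumes "regular_pairing P"
  shows "(\<forall>l>0. lipschitz_op l T \<longleftrightarrow> SRG_L P T \<subseteq> {z. ext_cmod z \<le> ereal l})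
    \<and> (\<forall>c. one_sided_lipschitz P c T \<longleftrightarrow> SRG_L P T \<subseteq> Re_le_halfplane c)
    \<and> (\<forall>\<mu>\<ge>0. strongly_monotone P \<mu> T \<longleftrightarrow> SRG_L P T \<subseteq> Re_ge_halfplane \<mu>)
    \<and> (\<forall>\<gamma>>0. cocoercive P \<gamma> T \<longleftrightarrow>
          SRG_L P T \<subseteq> {z. ext_cmod (ext_diff z (of_real (1 / (2 * \<gamma>)))) \<le> ereal (1 / (2 * \<gamma>))})"
proof -
  interpret regular_pairing P by fact
  show ?thesis
    unfolding SRG_L_subset_iff lipschitz_op_def one_sided_lipschitz_def strongly_monotone_def
      cocoercive_def
    \<comment> \<open>\<open>imp_cong\<close> makes the guards on l and \<gamma> available to the
      conditional rewrites.\<close>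
    by (simp only: SRG_points_subset_disc_iff SRG_points_subset_Re_le_iff
        SRG_points_subset_Re_ge_iff SRG_points_subset_cocoercive_disc_iff cong: imp_cong) simp
qed

end
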